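(* Let $G=(V,E)$ be a graph with $|V|=n$ and let $k$ be an integer with $0\leqslant k\leqslant n$. Then $z^{\mathcal{E}}_{k}(G)\leqslant z^{\mathcal{C}}_{k}(G)$.
   Context: Graphs are finite, simple and undirected, with vertex set $V=\{1,\dots,n\}$, $n\geqslant 1$. $\mathcal{S}_n$ denotes the set of real symmetric $n\times n$ matrices, $\mathbf{1}_n$ the all-ones vector, $\mathbf{1}_{n\times n}$ the all-ones matrix, $\langle X,Y\rangle=\sum_{i,j}X_{i,j}Y_{i,j}$, $\operatorname{diag}(X)$ the vector of main-diagonal entries of $X$, and $X\succcurlyeq 0$ means positive semidefinite. For a graph $H$, the set of stable set vectors is $\mathcal{S}(H)=\{s\in\{0,1\}^{V(H)} : s_is_j=0 \text{ for all } \{i,j\}\in E(H)\}$, and the squared stable set polytope is $\operatorname{STAB}^2(H)=\operatorname{conv}\{ss^T : s\in\mathcal{S}(H)\}$. For $I\subseteq V$, $G_I$ is the subgraph of $G$ induced by $I$, and for an $n\times n$ matrix $X$, $X_I=(X_{i,j})_{i,j\in I}$. For $I=\emptyset$ the constraint $X_I\in\operatorname{STAB}^2(G_I)$ is vacuous. Define $$\operatorname{TH}^2(G)=\{(x,X)\in\mathbb{R}^n\times\mathcal{S}_n : \operatorname{diag}(X)=x,\ X_{i,j}=0\ \forall\{i,j\}\in E,\ X-xx^T\succcurlyeq 0\},$$ $$\operatorname{CTH}^2(G)=\{X\in\mathcal{S}_n : \operatorname{trace}(X)=1,\ X_{i,j}=0\ \forall\{i,j\}\in E,\ X\succcurlyeq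 0\}.$$ The $k$-th levels of the exact subgraph hierarchy and of the compressed exact subgraph hierarchy are $$z^{\mathcal{E}}_{k}(G)=\max\{\mathbf{1}_n^Tx : (x,X)\in\operatorname{TH}^2(G),\ X_I\in\operatorname{STAB}^2(G_I)\ \forall I\subseteq V \text{ with } |I|=k\},$$ $$z^{\mathcal{C}}_{k}(G)=\max\{\langle\mathbf{1}_{n\times n},X\rangle : X\in\operatorname{CTH}^2(G),\ X_I\in\operatorname{STAB}^2(G_I)\ \forall I\subseteq V \text{ with } |I|=k\}.$$ *)

theory Defs
  imports "HOL-Analysis.Analysis"
begin

record 'v graph =
  verts :: "'v set"
  edges :: "'v set set"

definition simple_graph :: "'v graph \<Rightarrow> bool" where
  "simple_graph H \<longleftrightarrow> finite (verts H) \<and> (\<forall>e\<in>edges H. e \<subseteq> verts H \<and> card e = 2)"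

definition induced_subgraph :: "'v graph \<Rightarrow> 'v set \<Rightarrow> 'v graph" where
  "induced_subgraph G I = \<lparr>verts = I, edges = {e \<in> edges G. e \<subseteq> I}\<rparr>"

definition symmetric_matrices :: "(real^'n^'n) set" where
  "symmetric_matrices = {X. transpose X = X}"

definition psd :: "real^'n^'n \<Rightarrow> bool" where
  "psd X \<longleftrightarrow> X \<in> symmetric_matrices \<and> (\<forall>v. 0 \<le> v \<bullet> (X *v v))"

definition diag :: "real^'n^'n \<Rightarrow> real^'n" where
  "diag X = (\<chi> i. X $ i $ i)"

definition outer :: "real^'n \<Rightarrow> real^'n \<Rightarrow> real^'n^'n" where
  "outer x y = (\<chi> i j. x $ i * y $ j)"

text \<open>
  A vector (matrix) indexed by a subset \<open>I\<close> of the index type \<open>'n\<close> is represented by its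
  extension by zero to \<open>'n\<close>.  This is a linear embedding, so convex hulls are preserved.
  With this convention \<open>\<real>\<^sup>\<emptyset>\<close> is \<open>{0}\<close>, and for \<open>I = {}\<close> the constraint
  \<open>submatrix X I \<in> STAB2 (induced_subgraph G I)\<close> below reads \<open>0 \<in> {0}\<close>, i.e. it is vacuous.
\<close>

definition submatrix :: "real^'n^'n \<Rightarrow> 'n set \<Rightarrow> real^'n^'n" where
  "submatrix X I = (\<chi> i j. if i \<in> I \<and> j \<in> I then X $ i $ j else 0)"

definition stable_set_vectors :: "'n::finite graph \<Rightarrow> (real^'n) set" where
  "stable_set_vectors H = {s.
     (\<forall>i\<in>verts H. s $ i \<in> {0, 1}) \<and> (\<forall>i. i \<notin> verts H \<longrightarrow> s $ i = 0) \<and>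
     (\<forall>i j. {i, j} \<in> edges H \<longrightarrow> s $ i * s $ j = 0)}"

definition STAB2 :: "'n::finite graph \<Rightarrow> (real^'n^'n) set" where
  "STAB2 H = convex hull {outer s s | s. s \<in> stable_set_vectors H}"

definition TH2 :: "'n::finite graph \<Rightarrow> ((real^'n) \<times> (real^'n^'n)) set" where
  "TH2 G = {(x, X). X \<in> symmetric_matrices \<and> diag X = x \<and>
     (\<forall>i j. {i, j} \<in> edges G \<longrightarrow> X $ i $ j = 0) \<and> psd (X - outer x x)}"

definition CTH2 :: "'n::finite graph \<Rightarrow> (real^'n^'n) set" where
  "CTH2 G = {X. X \<in> symmetric_matrices \<and> trace X = 1 \<and>
     (\<forall>i j. {i, j} \<in> edges G \<longrightarrow> X $ i $ j = 0) \<and> psd X}"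

definition exact_subgraph_constraints :: "nat \<Rightarrow> 'n::finite graph \<Rightarrow> real^'n^'n \<Rightarrow> bool" where
  "exact_subgraph_constraints k G X \<longleftrightarrow>
     (\<forall>I. I \<subseteq> verts G \<and> card I = k \<longrightarrow> submatrix X I \<in> STAB2 (induced_subgraph G I))"

text \<open>
  The maxima below are genuine maxima (a largest element of the set of objective values),
  not suprema.  The inner product on \<open>real^'n^'n\<close> is the entrywise one, \<open>\<Sum>i j. X\<^sub>i\<^sub>j Y\<^sub>i\<^sub>j\<close>.
\<close>

definition z_exact :: "nat \<Rightarrow> 'n::finite graph \<Rightarrow> real" where
  "z_exact k G = (GREATEST z. z \<in>
     {(\<chi> i. 1) \<bullet> x | x X. (x, X) \<in> TH2 G \<and> exact_subgraph_constraints k G X})"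

definition z_compressed :: "nat \<Rightarrow> 'n::finite graph \<Rightarrow> real" where
  "z_compressed k G = (GREATEST z. z \<in>
     {(\<chi> i j. 1) \<bullet> X | X. X \<in> CTH2 G \<and> exact_subgraph_constraints k G X})"

end

theory Submission
  imports Defs
begin

text \<open>
  A feasible pair \<open>(x, X)\<close> of the exact hierarchy with value \<open>z = \<one>\<^sup>Tx\<close> is turned into the
  feasible matrix \<open>X / z\<close> of the compressed hierarchy.  Its trace is \<open>1\<close> because the diagonal
  of \<open>X\<close> is \<open>x\<close>; it is positive semidefinite because \<open>X = (X - xx\<^sup>T) + xx\<^sup>T\<close> is; and its
  objective value does not drop, because testing \<open>X - xx\<^sup>T \<succeq> 0\<close> against the all-ones vector
  gives \<open>\<one>\<^sup>TX\<one> \<ge> z\<^sup>2\<close>.  The polytopes \<open>STAB\<^sup>2\<close> are convex and contain \<open>0\<close> (the empty set is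
  stable), so they absorb scaling by \<open>1 / z\<close> as soon as \<open>z \<ge> 1\<close>; the optimal \<open>z\<close> satisfies
  this since a single vertex is a stable set (lemmas \<open>CTH2_scaled\<close>, \<open>ones_inner_scaled\<close> and
  \<open>exact_subgraph_constraints_scaled\<close>).

  The two levels are defined as greatest elements, so attainment of both maxima has to be
  established as well.  It follows from compactness of the feasible sets: they are closed, and
  bounded because a positive semidefinite matrix whose diagonal entries are at most \<open>1\<close> has all
  entries in \<open>[-1, 1]\<close> (lemma \<open>psd_entry_bound\<close>).
\<close>

section \<open>Positive semidefinite matrices\<close>

lemma quadratic_form_sum:
  fixes X :: "real^'n^'n"
  shows "v \<bullet> (X *v v) = (\<Sum>i\<in>UNIV. \<Sum>j\<in>UNIV. v $ i * X $ i $ j * v $ j)"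
  by (simp add: inner_vec_def matrix_vector_mult_def sum_distrib_left mult.assoc)

lemma quadratic_form_outer: "v \<bullet> (outer x x *v v) = (v \<bullet> x)\<^sup>2"
  unfolding quadratic_form_sum
  by (simp add: outer_def inner_vec_def power2_eq_square sum_product ac_simps)

lemma outer_symmetric: "outer x x \<in> symmetric_matrices"
  by (simp add: symmetric_matrices_def outer_def transpose_def vec_eq_iff mult.commute)

lemma psd_outer: "psd (outer x x)"
  by (simp add: psd_def outer_symmetric quadratic_form_outer)

lemma psd_add:
  assumes "psd X" "psd Y"
  shows "psd (X + Y)"
  using assms
  by (auto simp: psd_def symmetric_matrices_def transpose_def vec_eq_iff
      matrix_vector_mult_add_rdistrib inner_add_right)

lemma psd_scaleR:
  assumes "psd X" "0 \<le> c"
  shows "psd (c *\<^sub>R X)"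
  using assms
  by (auto simp: psd_def symmetric_matrices_def transpose_def vec_eq_iff
      scaleR_matrix_vector_assoc[symmetric])

lemma quadratic_form_axis_pair:
  fixes X :: "real^'n^'n"
  assumes "i \<noteq> j"
  shows "(axis i 1 + c *\<^sub>R axis j 1) \<bullet> (X *v (axis i 1 + c *\<^sub>R axis j 1)) =
    X $ i $ i + c * X $ i $ j + c * X $ j $ i + c\<^sup>2 * X $ j $ j"
  by (simp add: matrix_vector_right_distrib matrix_vector_mult_scaleR inner_add_left
      inner_axis' matrix_vector_mul_component inner_axis power2_eq_square algebra_simps)

lemma psd_diag_nonneg:
  assumes "psd X"
  shows "0 \<le> X $ i $ i"
proof -
  have "axis i 1 \<bullet> (X *v axis i 1) = X $ i $ i"
    by (simp add: inner_axis' matrix_vector_mul_component inner_axis)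
  then show ?thesis
    using assms unfolding psd_def by metis
qed

text \<open>
  The quadratic form at \<open>e\<^sub>i \<plusminus> e\<^sub>j\<close> is \<open>X\<^sub>i\<^sub>i + X\<^sub>j\<^sub>j \<plusminus> 2 X\<^sub>i\<^sub>j\<close>, which bounds the off-diagonal
  entries by the diagonal ones.
\<close>

lemma psd_entry_bound:
  assumes X: "psd X" and le: "\<And>i. X $ i $ i \<le> 1"
  shows "\<bar>X $ i $ j\<bar> \<le> 1"
proof (cases "i = j")
  case True
  then show ?thesis
    using psd_diag_nonneg[OF X, of i] le[of i] by simp
next
  case False
  have sym: "X $ j $ i = X $ i $ j"
    using X unfolding psd_def symmetric_matrices_def transpose_def
    by (auto simp: vec_eq_iff)
  have "0 \<le> X $ i $ i + c * X $ i $ j + c * X $ j $ i + c\<^sup>2 * X $ j $ j" for c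
    using X quadratic_form_axis_pair[OF False, of c X] unfolding psd_def by metis
  from this[of 1] this[of "-1"] show ?thesis
    using le[of i] le[of j] sym by auto
qed

lemma bounded_matrix_entries:
  fixes S :: "(real^'n^'m) set"
  assumes "\<And>X i j. X \<in> S \<Longrightarrow> \<bar>X $ i $ j\<bar> \<le> c"
  shows "bounded S"
proof -
  have "norm X \<le> (\<Sum>i\<in>(UNIV::'m set). \<Sum>j\<in>(UNIV::'n set). c)" if "X \<in> S" for X
  proof -
    have "norm X \<le> (\<Sum>i\<in>UNIV. norm (X $ i))"
      unfolding norm_vec_def by (rule L2_set_le_sum) simp
    also have "\<dots> \<le> (\<Sum>i\<in>UNIV. \<Sum>j\<in>UNIV. \<bar>X $ i $ j\<bar>)"
      by (intro sum_mono norm_le_l1_cart)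
    also have "\<dots> \<le> (\<Sum>i\<in>(UNIV::'m set). \<Sum>j\<in>(UNIV::'n set). c)"
      by (intro sum_mono assms that)
    finally show ?thesis .
  qed
  then show ?thesis
    unfolding bounded_iff by blast
qed

lemma closed_symmetric_matrices: "closed (symmetric_matrices :: (real^'n^'n) set)"
proof -
  have "symmetric_matrices = {X :: real^'n^'n. \<forall>i j. X $ j $ i = X $ i $ j}"
    by (auto simp: symmetric_matrices_def transpose_def vec_eq_iff)
  moreover have "closed {X :: real^'n^'n. \<forall>i j. X $ j $ i = X $ i $ j}"
    by (intro closed_Collect_all closed_Collect_eq continuous_intros)
  ultimately show ?thesis
    by simp
qed

lemma closed_psd_vimage:
  fixes f :: "real^'n^'n \<Rightarrow> real^'n^'n"
  assumes f: "continuous_on UNIV f"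
  shows "closed {X. psd (f X)}"
proof -
  have "closed (f -` symmetric_matrices)"
    using f closed_symmetric_matrices by (intro closed_vimage)
  moreover have "closed {X. \<forall>v. 0 \<le> v \<bullet> (f X *v v)}"
    unfolding quadratic_form_sum
    by (intro closed_Collect_all closed_Collect_le continuous_intros f)
  moreover have "{X. psd (f X)} = f -` symmetric_matrices \<inter> {X. \<forall>v. 0 \<le> v \<bullet> (f X *v v)}"
    by (auto simp: psd_def)
  ultimately show ?thesis
    by (simp add: closed_Int)
qed

section \<open>Exact subgraph constraints\<close>

lemma finite_stable_set_vectors: "finite (stable_set_vectors (H :: 'n::finite graph))"
proof (rule finite_subset)
  show "stable_set_vectors H \<subseteq> (\<lambda>A. \<chi> i. if i \<in> A then 1 else 0) ` Pow UNIV"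
  proof
    fix s assume s: "s \<in> stable_set_vectors H"
    have "s = (\<chi> i. if i \<in> {i. s $ i = 1} then 1 else 0)"
      using s by (auto simp: stable_set_vectors_def vec_eq_iff)
    then show "s \<in> (\<lambda>A. \<chi> i. if i \<in> A then 1 else 0) ` Pow UNIV"
      by blast
  qed
qed simp

lemma closed_STAB2: "closed (STAB2 (H :: 'n::finite graph))"
proof -
  have "finite {outer s s | s. s \<in> stable_set_vectors H}"
    using finite_stable_set_vectors by (intro finite_image_set) simp
  then show ?thesis
    unfolding STAB2_def by (intro compact_imp_closed finite_imp_compact_convex_hull)
qed

lemma zero_in_STAB2: "0 \<in> STAB2 (H :: 'n::finite graph)"
proof -
  have "0 \<in> stable_set_vectors H"
    by (simp add: stable_set_vectors_def)
  then have "outer 0 0 \<in> STAB2 H"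
    unfolding STAB2_def by (intro hull_inc) blast
  moreover have "outer 0 0 = (0 :: real^'n^'n)"
    by (simp add: outer_def vec_eq_iff)
  ultimately show ?thesis
    by simp
qed

lemma STAB2_scaleR:
  assumes "Y \<in> STAB2 H" "0 \<le> c" "c \<le> 1"
  shows "c *\<^sub>R Y \<in> STAB2 H"
proof -
  have "convex (STAB2 H)"
    by (simp add: STAB2_def)
  then have "c *\<^sub>R Y + (1 - c) *\<^sub>R 0 \<in> STAB2 H"
    using assms zero_in_STAB2 by (intro convexD) auto
  then show ?thesis
    by simp
qed

lemma exact_subgraph_constraints_scaled:
  assumes "exact_subgraph_constraints k G X" "0 \<le> c" "c \<le> 1"
  shows "exact_subgraph_constraints k G (c *\<^sub>R X)"
proof -
  have "submatrix (c *\<^sub>R X) I = c *\<^sub>R submatrix X I" for I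
    unfolding submatrix_def by (auto simp: vec_eq_iff)
  then show ?thesis
    using assms by (simp add: exact_subgraph_constraints_def STAB2_scaleR)
qed

lemma closed_exact_subgraph_constraints:
  "closed {X. exact_subgraph_constraints k (G :: 'n::finite graph) X}"
proof -
  have "continuous_on UNIV (\<lambda>X :: real^'n^'n. submatrix X I)" for I
  proof -
    have "continuous_on UNIV (\<lambda>X :: real^'n^'n. if i \<in> I \<and> j \<in> I then X $ i $ j else 0)" for i j
      by (cases "i \<in> I \<and> j \<in> I") (auto intro!: continuous_intros)
    then show ?thesis
      unfolding submatrix_def by (intro continuous_on_vec_lambda)
  qed
  then have "closed ((\<lambda>X. submatrix X I) -` STAB2 (induced_subgraph G I))" for I
    by (simp add: closed_vimage closed_STAB2)
  then have "closed (\<Inter>I\<in>{I. I \<subseteq> verts G \<and> card I = k}.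
      (\<lambda>X. submatrix X I) -` STAB2 (induced_subgraph G I))"
    by blast
  moreover have "{X. exact_subgraph_constraints k G X} =
      (\<Inter>I\<in>{I. I \<subseteq> verts G \<and> card I = k}.
        (\<lambda>X. submatrix X I) -` STAB2 (induced_subgraph G I))"
    by (auto simp: exact_subgraph_constraints_def)
  ultimately show ?thesis
    by simp
qed

section \<open>Compactness of the feasible sets\<close>

text \<open>
  Since \<open>x\<close> is the diagonal of \<open>X\<close>, the pairs in \<open>TH2\<close> are recorded by their matrices alone.
\<close>

definition exact_feasible :: "nat \<Rightarrow> 'n::finite graph \<Rightarrow> (real^'n^'n) set" where
  "exact_feasible k G = {X. (diag X, X) \<in> TH2 G \<and> exact_subgraph_constraints k G X}"

definition compressed_feasible :: "nat \<Rightarrow> 'n::finite graph \<Rightarrow> (real^'n^'n) set" where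
  "compressed_feasible k G = {X. X \<in> CTH2 G \<and> exact_subgraph_constraints k G X}"

lemma z_exact_eq:
  "z_exact k G = (GREATEST z. z \<in> (\<lambda>X. (\<chi> i. 1) \<bullet> diag X) ` exact_feasible k G)"
proof -
  have "{(\<chi> i. 1) \<bullet> x | x X. (x, X) \<in> TH2 G \<and> exact_subgraph_constraints k G X} =
      (\<lambda>X. (\<chi> i. 1) \<bullet> diag X) ` exact_feasible k G"
    by (auto simp: exact_feasible_def TH2_def)
  then show ?thesis
    by (simp add: z_exact_def)
qed

lemma z_compressed_eq:
  "z_compressed k G = (GREATEST z. z \<in> (\<lambda>X. (\<chi> i j. 1) \<bullet> X) ` compressed_feasible k G)"
proof -
  have "{(\<chi> i j. 1) \<bullet> X | X. X \<in> CTH2 G \<and> exact_subgraph_constraints k G X} =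
      (\<lambda>X. (\<chi> i j. 1) \<bullet> X) ` compressed_feasible k G"
    by (auto simp: compressed_feasible_def)
  then show ?thesis
    by (simp add: z_compressed_def)
qed

lemma TH2_psd:
  assumes "(x, X) \<in> TH2 G"
  shows "psd X"
  using psd_add[of "X - outer x x" "outer x x"] assms by (simp add: TH2_def psd_outer)

text \<open>
  The diagonal entries of \<open>X - xx\<^sup>T\<close> are \<open>x\<^sub>i - x\<^sub>i\<^sup>2\<close>, and nonnegativity confines \<open>x\<^sub>i\<close> to
  \<open>[0, 1]\<close>.
\<close>

lemma TH2_diag_le_1:
  assumes "(x, X) \<in> TH2 G"
  shows "X $ i $ i \<le> 1"
proof -
  have "x = diag X" "psd (X - outer x x)"
    using assms by (auto simp: TH2_def)
  then have "0 \<le> X $ i $ i - X $ i $ i * X $ i $ i"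
    using psd_diag_nonneg[of "X - outer x x" i] by (simp add: outer_def diag_def)
  then show ?thesis
    by (smt (verit) mult_less_cancel_left1)
qed

lemma CTH2_diag_le_1:
  assumes "X \<in> CTH2 G"
  shows "X $ i $ i \<le> 1"
proof -
  have "X $ i $ i \<le> (\<Sum>j\<in>UNIV. X $ j $ j)"
    using assms psd_diag_nonneg by (intro member_le_sum) (auto simp: CTH2_def)
  then show ?thesis
    using assms by (simp add: CTH2_def trace_def)
qed

lemma compact_exact_feasible: "compact (exact_feasible k (G :: 'n::finite graph))"
proof (rule compact_eq_bounded_closed[THEN iffD2], rule conjI)
  show "bounded (exact_feasible k G)"
  proof (rule bounded_matrix_entries)
    fix X i j assume "X \<in> exact_feasible k G"
    then show "\<bar>X $ i $ j\<bar> \<le> 1"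
      unfolding exact_feasible_def using psd_entry_bound TH2_psd TH2_diag_le_1 by blast
  qed
  have "continuous_on UNIV (\<lambda>X :: real^'n^'n. outer (diag X) (diag X))"
    unfolding outer_def diag_def
    by (auto intro!: continuous_intros continuous_on_vec_lambda)
  then have "closed (symmetric_matrices \<inter> {X. \<forall>i j. {i, j} \<in> edges G \<longrightarrow> X $ i $ j = 0} \<inter>
      {X. psd (X - outer (diag X) (diag X))} \<inter> {X. exact_subgraph_constraints k G X})"
    by (intro closed_Int closed_symmetric_matrices closed_psd_vimage
        closed_exact_subgraph_constraints closed_Collect_all closed_Collect_imp
        closed_Collect_eq continuous_intros) simp_all
  moreover have "exact_feasible k G = symmetric_matrices \<inter>
      {X. \<forall>i j. {i, j} \<in> edges G \<longrightarrow> X $ i $ j = 0} \<inter>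
      {X. psd (X - outer (diag X) (diag X))} \<inter> {X. exact_subgraph_constraints k G X}"
    by (auto simp: exact_feasible_def TH2_def)
  ultimately show "closed (exact_feasible k G)"
    by simp
qed

lemma compact_compressed_feasible: "compact (compressed_feasible k (G :: 'n::finite graph))"
proof (rule compact_eq_bounded_closed[THEN iffD2], rule conjI)
  show "bounded (compressed_feasible k G)"
  proof (rule bounded_matrix_entries)
    fix X i j assume "X \<in> compressed_feasible k G"
    then show "\<bar>X $ i $ j\<bar> \<le> 1"
      unfolding compressed_feasible_def
      using psd_entry_bound[of X] CTH2_diag_le_1[of X G] by (simp add: CTH2_def)
  qed
  have "closed (symmetric_matrices \<inter> {X. (\<Sum>i\<in>UNIV. X $ i $ i) = 1} \<inter>
      {X. \<forall>i j. {i, j} \<in> edges G \<longrightarrow> X $ i $ j = 0} \<inter>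
      {X. psd X} \<inter> {X. exact_subgraph_constraints k G X})"
    by (intro closed_Int closed_symmetric_matrices closed_psd_vimage
        closed_exact_subgraph_constraints closed_Collect_all closed_Collect_imp
        closed_Collect_eq continuous_intros) auto
  moreover have "compressed_feasible k G = symmetric_matrices \<inter>
      {X. (\<Sum>i\<in>UNIV. X $ i $ i) = 1} \<inter>
      {X. \<forall>i j. {i, j} \<in> edges G \<longrightarrow> X $ i $ j = 0} \<inter>
      {X. psd X} \<inter> {X. exact_subgraph_constraints k G X}"
    by (auto simp: compressed_feasible_def CTH2_def trace_def)
  ultimately show "closed (compressed_feasible k G)"
    by simp
qed

lemma Greatest_image_compact:
  fixes f :: "'a::topological_space \<Rightarrow> real"
  assumes "compact S" "S \<noteq> {}" "continuous_on S f"
  obtains x where "x \<in> S" "(GREATEST z. z \<in> f ` S) = f x" "\<And>y. y \<in> S \<Longrightarrow> f y \<le> f x"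
proof -
  obtain x where x: "x \<in> S" "\<forall>y\<in>S. f y \<le> f x"
    using continuous_attains_sup[OF assms] by blast
  moreover from this have "(GREATEST z. z \<in> f ` S) = f x"
    by (intro Greatest_equality) auto
  ultimately show ?thesis
    using that by blast
qed

section \<open>From the exact to the compressed hierarchy\<close>

text \<open>
  A single vertex is stable, so \<open>e\<^sub>ie\<^sub>i\<^sup>T\<close> is feasible.  Absence of loops matters here: an edge
  \<open>{i, i}\<close> would force the diagonal entry at \<open>i\<close> to vanish.
\<close>

lemma single_vertex_exact_feasible:
  fixes G :: "'n::finite graph"
  assumes "simple_graph G"
  shows "outer (axis i 1) (axis i 1) \<in> exact_feasible k G"
proof -
  let ?e = "axis i 1 :: real^'n"
  have no_loop: "{i, i} \<notin> edges G"
    using assms by (force simp: simple_graph_def)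
  have diag: "diag (outer ?e ?e) = ?e"
    by (simp add: diag_def outer_def axis_def vec_eq_iff)
  have zero: "outer ?e ?e $ a $ b = 0" if "{a, b} \<in> edges G" for a b
    using that no_loop by (auto simp: outer_def axis_def)
  have "psd (0 :: real^'n^'n)"
    by (simp add: psd_def symmetric_matrices_def transpose_def vec_eq_iff)
  then have "(?e, outer ?e ?e) \<in> TH2 G"
    using diag zero by (simp add: TH2_def outer_symmetric)
  moreover have "submatrix (outer ?e ?e) I \<in> STAB2 (induced_subgraph G I)" for I
  proof -
    let ?s = "\<chi> j. if j \<in> I then ?e $ j else 0"
    have "?s \<in> stable_set_vectors (induced_subgraph G I)"
      using no_loop by (auto simp: stable_set_vectors_def induced_subgraph_def axis_def)
    moreover have "submatrix (outer ?e ?e) I = outer ?s ?s"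
      by (simp add: submatrix_def outer_def vec_eq_iff)
    ultimately show ?thesis
      unfolding STAB2_def by (intro hull_inc) auto
  qed
  ultimately show ?thesis
    by (simp add: exact_feasible_def exact_subgraph_constraints_def diag)
qed

lemma ones_inner_diag: "(\<chi> i. 1) \<bullet> diag X = trace X"
  by (simp add: inner_vec_def diag_def trace_def)

lemma CTH2_scaled:
  assumes "(x, X) \<in> TH2 G" "0 < trace X"
  shows "(1 / trace X) *\<^sub>R X \<in> CTH2 G"
proof -
  have psd: "psd ((1 / trace X) *\<^sub>R X)"
    using assms by (intro psd_scaleR TH2_psd) auto
  have "trace ((1 / trace X) *\<^sub>R X) = (1 / trace X) * trace X"
    by (simp add: trace_def sum_distrib_left)
  then show ?thesis
    using assms psd by (auto simp: CTH2_def TH2_def psd_def)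
qed

text \<open>Positive semidefiniteness of \<open>X - xx\<^sup>T\<close>, tested against the all-ones vector.\<close>

lemma ones_inner_ge_trace_squared:
  assumes "(x, X) \<in> TH2 G"
  shows "(trace X)\<^sup>2 \<le> (\<chi> i j. 1) \<bullet> X"
proof -
  let ?u = "\<chi> i. 1"
  have x: "x = diag X" and "0 \<le> ?u \<bullet> ((X - outer x x) *v ?u)"
    using assms by (auto simp: TH2_def psd_def)
  then have "(?u \<bullet> x)\<^sup>2 \<le> ?u \<bullet> (X *v ?u)"
    by (simp add: matrix_vector_mult_diff_rdistrib inner_diff_right quadratic_form_outer)
  moreover have "?u \<bullet> (X *v ?u) = (\<chi> i j. 1) \<bullet> X"
    unfolding quadratic_form_sum by (simp add: inner_vec_def)
  ultimately show ?thesis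
    by (simp add: x ones_inner_diag)
qed

lemma ones_inner_scaled:
  assumes "(x, X) \<in> TH2 G" "0 < trace X"
  shows "trace X \<le> (\<chi> i j. 1) \<bullet> ((1 / trace X) *\<^sub>R X)"
  using ones_inner_ge_trace_squared[OF assms(1)] assms(2)
  by (simp add: field_simps power2_eq_square)

theorem corollary1:
  fixes G :: "'n::finite graph" and k :: nat
  assumes "simple_graph G" and "verts G = UNIV"
    and "k \<le> CARD('n)"
  shows "z_exact k G \<le> z_compressed k G"
proof -
  \<comment> \<open>Any vertex serves as the stable set that witnesses an optimal value of at least \<open>1\<close>.\<close>
  let ?e = "axis undefined 1 :: real^'n"
  have e: "outer ?e ?e \<in> exact_feasible k G"
    using assms(1) by (rule single_vertex_exact_feasible)
  have "continuous_on (exact_feasible k G) trace"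
    unfolding trace_def by (intro continuous_intros)
  then obtain X where X: "X \<in> exact_feasible k G" "z_exact k G = trace X"
    and max: "\<And>Y. Y \<in> exact_feasible k G \<Longrightarrow> trace Y \<le> trace X"
    using Greatest_image_compact[OF compact_exact_feasible, of k G trace] e
    unfolding z_exact_eq ones_inner_diag by blast
  have "trace (outer ?e ?e) = 1"
    by (simp add: trace_def outer_def axis_def if_distrib cong: if_cong)
  then have ge1: "1 \<le> trace X"
    using max[OF e] by simp
  have TH: "(diag X, X) \<in> TH2 G" and ESC: "exact_subgraph_constraints k G X"
    using X(1) by (auto simp: exact_feasible_def)
  \<comment> \<open>On the exact side the objective value \<open>\<one>\<^sup>Tx\<close> is the trace of \<open>X\<close>.\<close>
  let ?Y = "(1 / trace X) *\<^sub>R X"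
  have Y: "?Y \<in> compressed_feasible k G"
    using CTH2_scaled[OF TH] exact_subgraph_constraints_scaled[OF ESC, of "1 / trace X"] ge1
    by (simp add: compressed_feasible_def)
  have "continuous_on (compressed_feasible k G) (\<lambda>Z. (\<chi> i j. 1) \<bullet> Z)"
    by (intro continuous_intros)
  then have "(\<chi> i j. 1) \<bullet> ?Y \<le> z_compressed k G"
    using Greatest_image_compact[OF compact_compressed_feasible, of k G "\<lambda>Z. (\<chi> i j. 1) \<bullet> Z"] Y
    unfolding z_compressed_eq by (metis empty_iff)
  then show ?thesis
    using ones_inner_scaled[OF TH] ge1 X(2) by linarith
qed

end
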